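(* Let $K$ be the $2$-adic integer such that, for all positive integers $d$ and all integers $e>d$, $$\operatorname{uns}(e,d)+K\equiv \operatorname{stab}(e+1,d)\pmod{2^d}.$$ Then $K=-zw$.
   Context: For a positive integer $n$, $\nu(n)$ is the exponent of $2$ in the prime factorization of $n$, and $\operatorname{od}(n)=n/2^{\nu(n)}$ is the odd part of $n$. The notation $2^e!$ means $(2^e)!$, and $(2^e-1)!!$ is the product of all odd positive integers less than $2^e$. $z$ is the $2$-adic integer $\lim_{e\to\infty}\operatorname{od}(2^e!)$ ($2$-adic limit); it is known to exist and to satisfy $z\equiv\operatorname{od}(2^{e-1}!)\pmod{2^e}$ for all $e\ge3$. $w$ is the $2$-adic integer satisfying $w\equiv\frac{(2^e-1)!!-1}{2^e}\pmod{2^{e-1}}$ for all $e\ge3$ (these fractions are integers for $e\ge 3$, and consecutive ones, for $e$ and $e+1$, are congruent mod $2^{e-1}$, so $w$ is well defined). The bit in position $i$ of a ($2$-adic) integer is the coefficient of $2^i$ in its binary expansion. $\operatorname{uns}(e,d)=\sum_{i=0}^{d-1}u_i2^i$, where $u_i$ is the bit of $\operatorname{od}(2^e!)$ in position $e+1+i$. $\operatorname{stab}(e+1,d)=\sum_{i=0}^{d-1}s_i2^i$, where $s_i$ is the bit of $z$ in position $e+1+i$. It is part of the paper's results that a $2$-adic integer $K$ with the stated property exists. *)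

theory Defs
  imports Complex_Main "HOL-Computational_Algebra.Primes"
begin

section \<open>The ring of 2-adic integers\<close>

text \<open>The inverse limit of the rings of residues modulo \<open>2 ^ n\<close>, the residue at level \<open>n\<close> being
  represented by an element of \<open>{0..<2 ^ n}\<close>; see \<open>residue_range\<close>.\<close>

typedef two_adic = "{x :: nat \<Rightarrow> int. \<forall>n. x (Suc n) mod 2 ^ n = x n}"
  morphisms residue Abs_two_adic
  by (rule exI[of _ "\<lambda>_. 0"]) simp

setup_lifting type_definition_two_adic

lemma residue_Suc_mod: "residue x (Suc n) mod 2 ^ n = residue x n"
  using residue[of x] by blast

lemma residue_range: "residue x n \<in> {0..<2 ^ n}"
  using residue_Suc_mod[of x n] pos_mod_bound[of "2 ^ n" "residue x (Suc n)"]
    pos_mod_sign[of "2 ^ n" "residue x (Suc n)"] by auto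

lemma residue_mod_self [simp]: "residue x n mod 2 ^ n = residue x n"
  using residue_range[of x n] by simp

lemma mod_mod_power2_Suc: "(a :: int) mod 2 ^ Suc n mod 2 ^ n = a mod 2 ^ n"
  by (rule mod_mod_cancel) (simp add: le_imp_power_dvd)

lemma residue_mod:
  assumes "m \<le> n"
  shows "residue x n mod 2 ^ m = residue x m"
  using assms
proof (induction n rule: dec_induct)
  case (step n)
  have "residue x (Suc n) mod 2 ^ m = residue x (Suc n) mod 2 ^ n mod 2 ^ m"
    using step.hyps by (intro mod_mod_cancel [symmetric]) (simp add: le_imp_power_dvd)
  then show ?case
    using step.IH by (simp add: residue_Suc_mod)
qed simp

lemma two_adic_eqI: "(\<And>n. residue x n = residue y n) \<Longrightarrow> x = y"
  by (simp add: residue_inject[symmetric] fun_eq_iff)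

instantiation two_adic :: comm_ring_1
begin

lift_definition zero_two_adic :: two_adic is "\<lambda>_. 0" by simp

lift_definition one_two_adic :: two_adic is "\<lambda>n. 1 mod 2 ^ n"
  by (intro allI mod_mod_power2_Suc)

lift_definition plus_two_adic :: "two_adic \<Rightarrow> two_adic \<Rightarrow> two_adic"
  is "\<lambda>x y n. (x n + y n) mod 2 ^ n"
  by (metis mod_add_eq mod_mod_power2_Suc)

lift_definition times_two_adic :: "two_adic \<Rightarrow> two_adic \<Rightarrow> two_adic"
  is "\<lambda>x y n. (x n * y n) mod 2 ^ n"
  by (metis mod_mult_eq mod_mod_power2_Suc)

lift_definition uminus_two_adic :: "two_adic \<Rightarrow> two_adic"
  is "\<lambda>x n. (- x n) mod 2 ^ n"
  by (metis mod_minus_eq mod_mod_power2_Suc)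

lift_definition minus_two_adic :: "two_adic \<Rightarrow> two_adic \<Rightarrow> two_adic"
  is "\<lambda>x y n. (x n - y n) mod 2 ^ n"
  by (metis mod_diff_eq mod_mod_power2_Suc)

instance
proof
  fix a b c :: two_adic
  show "a + b + c = a + (b + c)"
    by (rule two_adic_eqI) (simp add: plus_two_adic.rep_eq mod_simps add.assoc)
  show "a + b = b + a"
    by (rule two_adic_eqI) (simp add: plus_two_adic.rep_eq add.commute)
  show "0 + a = a"
    by (rule two_adic_eqI) (simp add: plus_two_adic.rep_eq zero_two_adic.rep_eq)
  show "- a + a = 0"
    by (rule two_adic_eqI)
      (simp add: plus_two_adic.rep_eq uminus_two_adic.rep_eq zero_two_adic.rep_eq mod_simps)
  show "a - b = a + - b"
    by (rule two_adic_eqI)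
      (simp add: plus_two_adic.rep_eq uminus_two_adic.rep_eq minus_two_adic.rep_eq mod_simps)
  show "a * b * c = a * (b * c)"
    by (rule two_adic_eqI) (simp add: times_two_adic.rep_eq mod_simps mult.assoc)
  show "a * b = b * a"
    by (rule two_adic_eqI) (simp add: times_two_adic.rep_eq mult.commute)
  show "1 * a = a"
    by (rule two_adic_eqI)
      (simp only: times_two_adic.rep_eq one_two_adic.rep_eq mod_mult_left_eq mult_1_left residue_mod_self)
  show "(a + b) * c = a * c + b * c"
    by (rule two_adic_eqI)
      (simp add: times_two_adic.rep_eq plus_two_adic.rep_eq mod_simps distrib_right)
  have "residue 0 1 \<noteq> residue 1 1"
    by (simp add: zero_two_adic.rep_eq one_two_adic.rep_eq)
  then show "(0 :: two_adic) \<noteq> 1" by metis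
qed

end

lemma residue_of_nat: "residue (of_nat k) n = int k mod 2 ^ n"
  by (induction k)
    (simp_all add: zero_two_adic.rep_eq plus_two_adic.rep_eq one_two_adic.rep_eq mod_simps)

lemma residue_of_int: "residue (of_int k) n = k mod 2 ^ n"
  by (cases k rule: int_cases2)
    (simp_all add: uminus_two_adic.rep_eq residue_of_nat mod_simps)

lemma two_power_dvd_iff_residue: "2 ^ n dvd x \<longleftrightarrow> residue x n = 0" for x :: two_adic
proof
  have pow: "(2 :: two_adic) ^ n = of_int (2 ^ n)" by simp
  {
    assume "2 ^ n dvd x"
    then obtain y where "x = of_int (2 ^ n) * y" unfolding pow by (elim dvdE)
    then show "residue x n = 0"
      by (simp add: times_two_adic.rep_eq residue_of_int del: of_int_power)
  }
  assume *: "residue x n = 0"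
  define f where "f m = residue x (n + m) div 2 ^ n" for m
  have f: "residue x (n + m) = 2 ^ n * f m" for m
    using residue_mod[of n "n + m" x] * unfolding f_def by (simp add: mod_0_imp_dvd)
  have "f (Suc m) mod 2 ^ m = f m" for m
  proof -
    have "2 ^ n * f (Suc m) mod (2 ^ n * 2 ^ m) = 2 ^ n * f m"
      using residue_Suc_mod[of x "n + m"] f[of "Suc m"] f[of m] by (simp add: power_add)
    then show ?thesis by (simp add: mod_mult_mult1)
  qed
  then have res: "residue (Abs_two_adic f) = f" by (intro Abs_two_adic_inverse) simp
  have "x = of_int (2 ^ n) * Abs_two_adic f"
  proof (rule two_adic_eqI)
    fix m
    have "residue x m = residue x (n + m) mod 2 ^ m" by (simp add: residue_mod)
    also have "\<dots> = 2 ^ n * f m mod 2 ^ m" by (simp add: f)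
    also have "\<dots> = residue (of_int (2 ^ n) * Abs_two_adic f) m"
      by (simp add: times_two_adic.rep_eq residue_of_int res mod_simps del: of_int_power)
    finally show "residue x m = residue (of_int (2 ^ n) * Abs_two_adic f) m" .
  qed
  then show "2 ^ n dvd x" unfolding pow by (rule dvdI)
qed

definition cong_pow2 :: "nat \<Rightarrow> two_adic \<Rightarrow> two_adic \<Rightarrow> bool"
  where "cong_pow2 n x y \<longleftrightarrow> 2 ^ n dvd x - y"

lemma cong_pow2_iff_residue: "cong_pow2 n x y \<longleftrightarrow> residue x n = residue y n"
proof -
  have "residue (x - y) n = 0 \<longleftrightarrow> residue x n mod 2 ^ n = residue y n mod 2 ^ n"
    by (simp only: minus_two_adic.rep_eq mod_eq_dvd_iff mod_eq_0_iff_dvd)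
  then show ?thesis by (simp add: cong_pow2_def two_power_dvd_iff_residue)
qed

subsection \<open>The 2-adic metric\<close>

text \<open>The distance of two distinct elements is \<open>(1/2) ^ n\<close>, where \<open>n\<close> is the exact power of 2
  dividing their difference, i.e. the last level at which the residues agree.\<close>

instantiation two_adic :: metric_space
begin

definition dist_two_adic :: "two_adic \<Rightarrow> two_adic \<Rightarrow> real" where
  "dist_two_adic x y =
     (if x = y then 0 else (1 / 2) ^ (LEAST n. \<not> cong_pow2 (Suc n) x y))"

definition uniformity_two_adic :: "(two_adic \<times> two_adic) filter" where
  "uniformity_two_adic = (INF e\<in>{0<..}. principal {(x, y). dist x y < e})"

definition open_two_adic :: "two_adic set \<Rightarrow> bool" where
  "open_two_adic U \<longleftrightarrow> (\<forall>x\<in>U. \<forall>\<^sub>F (x', y) in uniformity. x' = x \<longrightarrow> y \<in> U)"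

lemma dist_two_adic_le_iff: "dist x y \<le> (1 / 2) ^ n \<longleftrightarrow> cong_pow2 n x y" for x y :: two_adic
proof (cases "x = y")
  case False
  let ?P = "\<lambda>n. \<not> cong_pow2 (Suc n) x y"
  define k where "k = (LEAST n. ?P n)"
  obtain m where m: "residue x m \<noteq> residue y m" using False two_adic_eqI by blast
  moreover have "residue x 0 = residue y 0" using residue_range[of x 0] residue_range[of y 0] by simp
  ultimately obtain m' where "m = Suc m'" by (metis not0_implies_Suc)
  then have "?P m'" using m by (simp add: cong_pow2_iff_residue)
  then have k: "\<not> cong_pow2 (Suc k) x y" unfolding k_def by (rule LeastI)
  have agree: "cong_pow2 j x y" if "j \<le> k" for j
  proof (cases j)
    case 0
    then show ?thesis using \<open>residue x 0 = residue y 0\<close> by (simp add: cong_pow2_iff_residue)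
  next
    case (Suc i)
    then have "i < (LEAST n. ?P n)" using that by (simp add: k_def)
    then show ?thesis using Suc not_less_Least by blast
  qed
  have "cong_pow2 n x y \<longleftrightarrow> n \<le> k"
  proof
    assume *: "cong_pow2 n x y"
    show "n \<le> k"
    proof (rule ccontr)
      assume "\<not> n \<le> k"
      then have "cong_pow2 (Suc k) x y"
        using * residue_mod[of "Suc k" n x] residue_mod[of "Suc k" n y]
        by (simp add: cong_pow2_iff_residue)
      with k show False ..
    qed
  qed (rule agree)
  moreover have "dist x y = (1 / 2) ^ k" using False by (simp add: dist_two_adic_def k_def)
  ultimately show ?thesis by (simp add: power_decreasing_iff)
qed (simp add: dist_two_adic_def cong_pow2_def)

instance
proof
  show "uniformity = (INF e\<in>{0<..}. principal {(x :: two_adic, y). dist x y < e})"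
    by (rule uniformity_two_adic_def)
  show "open U \<longleftrightarrow> (\<forall>x\<in>U. \<forall>\<^sub>F (x', y) in uniformity. x' = x \<longrightarrow> y \<in> U)" for U :: "two_adic set"
    by (rule open_two_adic_def)
  show "dist x y = 0 \<longleftrightarrow> x = y" for x y :: two_adic
    by (simp add: dist_two_adic_def)
  fix x y z :: two_adic
  have pos: "0 \<le> dist a b" for a b :: two_adic by (simp add: dist_two_adic_def)
  show "dist x y \<le> dist x z + dist y z"
  proof (cases "x = z \<or> y = z")
    case True
    have "dist a b = dist b a" for a b :: two_adic
      by (simp add: dist_two_adic_def cong_pow2_iff_residue eq_commute)
    then show ?thesis using True pos[of x z] pos[of y z] by auto
  next
    case False
    then obtain i j where "dist x z = (1 / 2) ^ i" "dist y z = (1 / 2) ^ j"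
      by (simp add: dist_two_adic_def)
    moreover from this have "dist x z \<le> (1 / 2) ^ min i j" "dist y z \<le> (1 / 2) ^ min i j"
      by (simp_all add: power_decreasing)
    then have "dist x y \<le> (1 / 2) ^ min i j"
      unfolding dist_two_adic_le_iff by (simp add: cong_pow2_iff_residue)
    moreover have "(1 / 2 :: real) ^ min i j \<le> (1 / 2) ^ i + (1 / 2) ^ j"
      by (simp add: min_def)
    ultimately show ?thesis by linarith
  qed
qed

end

lemma two_adic_tendsto_iff:
  "(f \<longlongrightarrow> l) F \<longleftrightarrow> (\<forall>n. \<forall>\<^sub>F i in F. cong_pow2 n (f i) l)" for l :: two_adic
proof
  assume lim: "(f \<longlongrightarrow> l) F"
  show "\<forall>n. \<forall>\<^sub>F i in F. cong_pow2 n (f i) l"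
  proof
    fix n :: nat
    have "\<forall>\<^sub>F i in F. dist (f i) l < (1 / 2) ^ n"
      by (rule tendstoD [OF lim]) simp
    then show "\<forall>\<^sub>F i in F. cong_pow2 n (f i) l"
      by (rule eventually_mono) (rule iffD1 [OF dist_two_adic_le_iff less_imp_le])
  qed
next
  assume *: "\<forall>n. \<forall>\<^sub>F i in F. cong_pow2 n (f i) l"
  show "(f \<longlongrightarrow> l) F"
  proof (rule tendstoI)
    fix e :: real assume "0 < e"
    then obtain n where n: "(1 / 2) ^ n < e" using real_arch_pow_inv[of e "1 / 2"] by auto
    show "\<forall>\<^sub>F i in F. dist (f i) l < e"
      by (rule eventually_mono [OF *[rule_format, of n]])
        (rule le_less_trans [OF iffD2 [OF dist_two_adic_le_iff] n])
  qed
qed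

subsection \<open>Binary expansions\<close>

definition two_adic_bit :: "two_adic \<Rightarrow> nat \<Rightarrow> bool"
  where "two_adic_bit x i \<longleftrightarrow> bit (residue x (Suc i)) i"

lemma two_adic_bit_of_nat: "two_adic_bit (of_nat k) i \<longleftrightarrow> bit k i"
  unfolding two_adic_bit_def residue_of_nat take_bit_eq_mod [symmetric]
  by (simp add: bit_take_bit_iff bit_of_nat_iff_bit)

lemma residue_eq_sum_bits: "residue x n = (\<Sum>i<n. of_bool (two_adic_bit x i) * 2 ^ i)"
proof (induction n)
  case 0
  then show ?case using residue_range[of x 0] by simp
next
  case (Suc n)
  have "take_bit (Suc n) (residue x (Suc n)) =
      take_bit n (residue x (Suc n)) + of_bool (bit (residue x (Suc n)) n) * 2 ^ n"
    by (simp add: take_bit_Suc_from_most)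
  then show ?case
    using Suc residue_Suc_mod[of x n] residue_mod_self[of x "Suc n"]
    by (simp add: two_adic_bit_def take_bit_eq_mod del: residue_mod_self)
qed

lemma two_adic_bits_sums: "(\<lambda>i. of_bool (two_adic_bit x i) * 2 ^ i) sums x"
proof -
  have eq: "(\<Sum>i<m. of_bool (two_adic_bit x i) * 2 ^ i) = of_int (residue x m)" for m
    by (simp add: residue_eq_sum_bits)
  have "cong_pow2 n (\<Sum>i<m. of_bool (two_adic_bit x i) * 2 ^ i) x" if "n \<le> m" for n m
    using that by (simp only: eq cong_pow2_iff_residue residue_of_int residue_mod)
  then show ?thesis
    unfolding sums_def two_adic_tendsto_iff eventually_sequentially by blast
qed

section \<open>Odd parts of factorials and the constants \<open>z\<close> and \<open>w\<close>\<close>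

definition od :: "nat \<Rightarrow> nat"
  where "od n = n div 2 ^ multiplicity 2 n"

definition odd_prod :: "nat \<Rightarrow> nat" \<comment> \<open>\<open>(2 ^ e - 1)!!\<close>\<close>
  where "odd_prod e = \<Prod>{j. odd j \<and> j < 2 ^ e}"

definition z_const :: two_adic
  where "z_const = lim (\<lambda>e. of_nat (od (fact (2 ^ e))))"

text \<open>For \<open>e \<ge> 3\<close> the division is exact.\<close>

definition w_const :: two_adic
  where "w_const = (THE w. \<forall>e\<ge>3. cong_pow2 (e - 1) w (of_int ((int (odd_prod e) - 1) div 2 ^ e)))"

definition uns :: "nat \<Rightarrow> nat \<Rightarrow> nat"
  where "uns e d = (\<Sum>i<d. of_bool (bit (od (fact (2 ^ e))) (e + 1 + i)) * 2 ^ i)"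

text \<open>Here the first argument is the starting position itself: the bits of \<open>stab (e + 1) d\<close>
  start at position \<open>e + 1\<close>, as do those of \<open>uns e d\<close>.\<close>

definition stab :: "nat \<Rightarrow> nat \<Rightarrow> nat"
  where "stab m d = (\<Sum>i<d. of_bool (two_adic_bit z_const (m + i)) * 2 ^ i)"

definition uns_stab_difference :: "two_adic \<Rightarrow> bool"
  where "uns_stab_difference K \<longleftrightarrow>
    (\<forall>d>0. \<forall>e>d. cong_pow2 d (of_nat (uns e d) + K) (of_nat (stab (e + 1) d)))"

end

(* Write a_e = od(2^e!) (odf below) and P_e = (2^e - 1)!! = 1 + 2^e w_e (w_e is wq below), so that
   a_(e+1) = a_e P_(e+1). Since (2^e + j)(2^(e+1) - j) = j (2^e - j) mod 2^(2e), pairing factors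
   yields P_(e+1) = P_e^2 mod 2^(2e), whence w_(e+1) = w_e mod 2^(e-1).
   The quantity b_e = z - a_e + 2^(e+1) z w satisfies
   b_(e+1) - b_e = 2^(e+1) (z w - a_e w_(e+1)) = 0 mod 2^(2e+1), and b_e tends to 0; hence
   z - a_e = - 2^(e+1) z w mod 2^(2e+1). Since z and a_e share their lowest e + 1 bits, dividing
   by 2^(e+1) compares the next d bits. *)
theory Submission
  imports Defs "HOL-Number_Theory.Cong"
begin

section \<open>Double factorials modulo powers of 2\<close>

text \<open>As \<open>n\<close> is even, translation by \<open>n\<close> preserves parity and
  carries the odd numbers below \<open>n\<close> onto those between \<open>n\<close> and
  \<open>2 * n\<close>.\<close>

lemma prod_odd_less_double_shift:
  assumes "even (n::nat)"
  shows "(\<Prod>j | odd j \<and> j < 2 * n. f j) =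
    (\<Prod>j | odd j \<and> j < n. f j) * (\<Prod>j | odd j \<and> j < n. f (n + j) :: 'a :: comm_monoid_mult)"
proof -
  have "{j. odd j \<and> j < 2 * n} = {j. odd j \<and> j < n} \<union> (+) n ` {j. odd j \<and> j < n}"
  proof (intro equalityI subsetI)
    fix x assume x: "x \<in> {j. odd j \<and> j < 2 * n}"
    show "x \<in> {j. odd j \<and> j < n} \<union> (+) n ` {j. odd j \<and> j < n}"
    proof (cases "x < n")
      case False
      then have "x = n + (x - n)" "odd (x - n)" "x - n < n" using x assms by auto
      then show ?thesis by blast
    qed (use x in simp)
  qed (use assms in auto)
  then show ?thesis
    by (simp, subst prod.union_disjoint) (auto simp: prod.reindex)
qed

text \<open>Reflection in the midpoint \<open>n\<close> preserves parity and swaps the two halves;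
  the midpoint, being even, is not an index.\<close>

lemma prod_odd_less_double_reflect:
  assumes "even (n::nat)"
  shows "(\<Prod>j | odd j \<and> j < 2 * n. f j) =
    (\<Prod>j | odd j \<and> j < n. f j * f (2 * n - j) :: 'a :: comm_monoid_mult)"
proof -
  have "{j. odd j \<and> j < 2 * n} = {j. odd j \<and> j < n} \<union> (-) (2 * n) ` {j. odd j \<and> j < n}"
  proof (intro equalityI subsetI)
    fix x assume x: "x \<in> {j. odd j \<and> j < 2 * n}"
    show "x \<in> {j. odd j \<and> j < n} \<union> (-) (2 * n) ` {j. odd j \<and> j < n}"
    proof (cases "x < n")
      case False
      moreover have "x \<noteq> n" using x assms by auto
      ultimately have "x = 2 * n - (2 * n - x)" "odd (2 * n - x)" "2 * n - x < n" using x by auto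
      then show ?thesis by blast
    qed (use x in simp)
  qed (use assms in \<open>auto elim: oddE\<close>)
  moreover have "{j. odd j \<and> j < n} \<inter> (-) (2 * n) ` {j. odd j \<and> j < n} = {}"
    by (rule equals0I) (elim IntE imageE CollectE conjE, linarith)
  ultimately have "(\<Prod>j | odd j \<and> j < 2 * n. f j) =
      (\<Prod>j | odd j \<and> j < n. f j) * prod f ((-) (2 * n) ` {j. odd j \<and> j < n})"
    by (simp only:) (rule prod.union_disjoint; simp)
  also have "prod f ((-) (2 * n) ` {j. odd j \<and> j < n}) = (\<Prod>j | odd j \<and> j < n. f (2 * n - j))"
    by (rule prod.reindex_cong[OF inj_onI]) auto
  finally show ?thesis by (simp add: prod.distrib)
qed

lemma odd_odd_prod: "odd (odd_prod e)"
  unfolding odd_prod_def by (subst even_prod_iff) auto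

text \<open>The factors below 2^e give \<open>odd_prod e\<close>; those above are 2^e + j. Pairing j
  with 2^e - j makes the upper product congruent to the lower one, each pair differing by exactly 2
  * 2^(2e).\<close>

lemma odd_prod_Suc_cong:
  assumes "e \<ge> 2"
  shows "[int (odd_prod (Suc e)) = (int (odd_prod e))\<^sup>2] (mod 2 ^ (2 * e))"
proof -
  obtain k where e: "e = Suc k" and k: "k \<ge> 1" using assms by (cases e) auto
  \<comment> \<open>\<open>?n\<close> is the midpoint of the reflection; e \<ge> 2 makes it
    even.\<close>
  let ?n = "2 ^ k :: nat" and ?N = "2 ^ e :: int"
  have ev: "even ?n" using k by simp
  have dbl: "2 ^ e = 2 * ?n" by (simp add: e)
  have ref: "int (odd_prod e) = (\<Prod>j | odd j \<and> j < ?n. int j * int (2 * ?n - j))"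
    unfolding odd_prod_def dbl of_nat_prod
    using prod_odd_less_double_reflect[OF ev, of int] by simp
  have "int (odd_prod (Suc e)) =
      (\<Prod>j | odd j \<and> j < 2 * 2 ^ e. int j)"
    by (simp add: odd_prod_def)
  also have "\<dots> = int (odd_prod e) * (\<Prod>j | odd j \<and> j < 2 * ?n. int (2 ^ e + j))"
    using prod_odd_less_double_shift[of "2 ^ e" int] assms by (simp add: odd_prod_def dbl)
  also have "(\<Prod>j | odd j \<and> j < 2 * ?n. int (2 ^ e + j)) =
      (\<Prod>j | odd j \<and> j < ?n. int (2 ^ e + j) * int (2 ^ e + (2 * ?n - j)))"
    using prod_odd_less_double_reflect[OF ev, of "\<lambda>j. int (2 ^ e + j)"] by simp
  finally have P: "int (odd_prod (Suc e)) = int (odd_prod e) *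
      (\<Prod>j | odd j \<and> j < ?n. int (2 ^ e + j) * int (2 ^ e + (2 * ?n - j)))" .
  have "[int (2 ^ e + j) * int (2 ^ e + (2 * ?n - j)) = int j * int (2 * ?n - j)]
      (mod 2 ^ (2 * e))" if "j < ?n" for j
  proof -
    have j: "int (2 * ?n - j) = ?N - int j" using that dbl by (simp add: of_nat_diff e)
    have "int (2 ^ e + j) * int (2 ^ e + (2 * ?n - j)) - int j * int (2 * ?n - j)
        = (?N + int j) * (?N + (?N - int j)) - int j * (?N - int j)"
      by (simp only: of_nat_add j of_nat_power of_nat_numeral)
    also have "\<dots> = 2 ^ (2 * e) * 2"
      unfolding mult_2 power_add by (simp add: algebra_simps)
    finally show ?thesis by (simp add: cong_iff_dvd_diff)
  qed
  then have "[(\<Prod>j | odd j \<and> j < ?n. int (2 ^ e + j) * int (2 ^ e + (2 * ?n - j))) =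
      int (odd_prod e)] (mod 2 ^ (2 * e))"
    unfolding ref by (intro cong_prod) simp
  then show ?thesis
    unfolding P power2_eq_square by (rule cong_scalar_left)
qed

text \<open>Squaring 1 + 2^e * v gains one factor 2, and the error modulo 2^(2e) is harmless since
  2e \<ge> e + 1. The induction starts from 1 * 3 * 5 * 7 = 1 + 8 * 13; for e = 2 the product 3 is
  not 1 modulo 4.\<close>

lemma odd_prod_cong_1:
  assumes "e \<ge> 3"
  shows "2 ^ e dvd int (odd_prod e) - 1"
  using assms
proof (induction e rule: dec_induct)
  case base
  have "odd j \<and> j < 8 \<longleftrightarrow> j = 1 \<or> j = 3 \<or> j = 5 \<or> j = 7" for j :: nat
    by presburger
  then have "{j::nat. odd j \<and> j < 2 ^ 3} = {1, 3, 5, 7}"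
    by auto
  then show ?case by (simp add: odd_prod_def)
next
  case (step e)
  then obtain v where v: "int (odd_prod e) = 1 + 2 ^ e * v"
    by (auto elim!: dvdE simp: algebra_simps)
  have "2 ^ Suc e dvd int (odd_prod (Suc e)) - (int (odd_prod e))\<^sup>2"
    using odd_prod_Suc_cong[of e] step.hyps
    by (intro power_le_dvd[where m = "Suc e" and n = "2 * e"]) (auto simp: cong_iff_dvd_diff)
  moreover have "(int (odd_prod e))\<^sup>2 - 1 = 2 ^ Suc e * (v + 2 ^ (e - 1) * v\<^sup>2)"
  proof -
    obtain k where "e = Suc k" using step.hyps by (cases e) auto
    then show ?thesis unfolding v by (simp add: power2_eq_square algebra_simps)
  qed
  ultimately have "2 ^ Suc e dvd
      (int (odd_prod (Suc e)) - (int (odd_prod e))\<^sup>2) + ((int (odd_prod e))\<^sup>2 - 1)"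
    by (intro dvd_add) simp_all
  then show ?case by simp
qed

definition wq :: "nat \<Rightarrow> int"
  where "wq e = (int (odd_prod e) - 1) div 2 ^ e"

lemma odd_prod_eq: "e \<ge> 3 \<Longrightarrow> int (odd_prod e) = 1 + 2 ^ e * wq e"
  using odd_prod_cong_1[of e] by (simp add: wq_def)

text \<open>Inserting \<open>odd_prod_eq\<close> into the squaring congruence leaves a square term
  that vanishes modulo 2^(2e+2); cancelling 2^(e+2) then leaves 2^e. The index \<open>Suc e\<close>
  avoids the exponent e - 1.\<close>

lemma wq_Suc_cong:
  assumes "Suc e \<ge> 3"
  shows "2 ^ e dvd wq (Suc (Suc e)) - wq (Suc e)"
proof -
  have "2 ^ (2 * Suc e) dvd int (odd_prod (Suc (Suc e))) - (int (odd_prod (Suc e)))\<^sup>2"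
    using odd_prod_Suc_cong[of "Suc e"] assms by (simp add: cong_iff_dvd_diff)
  also have "int (odd_prod (Suc (Suc e))) - (int (odd_prod (Suc e)))\<^sup>2 =
      2 ^ Suc (Suc e) * (wq (Suc (Suc e)) - wq (Suc e)) - 2 ^ (2 * Suc e) * (wq (Suc e))\<^sup>2"
  proof -
    have "2 ^ (2 * Suc e) = (2 ^ Suc e * 2 ^ Suc e :: int)"
      unfolding mult_2 power_add ..
    then show ?thesis
      using assms by (simp add: odd_prod_eq power2_eq_square algebra_simps)
  qed
  finally have "2 ^ (2 * Suc e) dvd 2 ^ Suc (Suc e) * (wq (Suc (Suc e)) - wq (Suc e))"
    using dvd_add[OF _ dvd_triv_left] by (metis diff_add_cancel)
  moreover have "2 * Suc e = Suc (Suc e) + e" by simp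
  ultimately have "2 ^ Suc (Suc e) * 2 ^ e dvd 2 ^ Suc (Suc e) * (wq (Suc (Suc e)) - wq (Suc e))"
    by (simp only: power_add)
  then show ?thesis
    by (subst (asm) dvd_mult_cancel_left) simp
qed

section \<open>Odd parts of factorials\<close>

lemma fact_double: "(fact (2 * n) :: nat) = 2 ^ n * fact n * \<Prod>{j. odd j \<and> j < 2 * n}"
proof (induction n)
  case (Suc n)
  have "{j. odd j \<and> j < 2 * Suc n} = insert (2 * n + 1) {j. odd j \<and> j < 2 * n}"
    by (auto simp: less_Suc_eq)
  then have "\<Prod>{j. odd j \<and> j < 2 * Suc n} = (2 * n + 1) * \<Prod>{j. odd j \<and> j < 2 * n}"
    by simp
  then show ?case using Suc by (simp add: algebra_simps)
qed simp

lemma od_mult_odd: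
  assumes "odd p" "m > 0"
  shows "od (2 ^ k * m * p) = od m * p"
proof -
  have "multiplicity 2 (2 ^ k * m * p) = k + multiplicity 2 m"
  proof -
    have "p \<noteq> 0" using assms by (metis even_zero)
    then show ?thesis
      using assms by (subst prime_elem_multiplicity_mult_distrib; simp add: not_dvd_imp_multiplicity_0)+
  qed
  moreover have "2 ^ multiplicity 2 m dvd m" by (rule multiplicity_dvd)
  ultimately show ?thesis
    by (simp add: od_def power_add div_mult_swap mult.assoc mult.commute[of _ p])
qed

definition odf :: "nat \<Rightarrow> nat"
  where "odf e = od (fact (2 ^ e))"

text \<open>\<open>fact_double\<close> at n = 2^e splits the larger factorial into a power of 2, the
  smaller factorial and an odd double factorial; the odd part drops only the power of 2.\<close>

lemma odf_Suc: "odf (Suc e) = odf e * odd_prod (Suc e)"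
  using od_mult_odd[OF odd_odd_prod[of "Suc e"], of "fact (2 ^ e)" "2 ^ e"] fact_double[of "2 ^ e"]
  by (simp add: odf_def odd_prod_def)

section \<open>The constants as 2-adic limits\<close>

text \<open>Compatible residues glue to an element of the inverse limit. This supplies the
  candidates for both \<open>z_const\<close> and \<open>w_const\<close>.\<close>

lemma residue_exists:
  assumes "\<And>n. 2 ^ n dvd f (Suc n) - f n"
  obtains x where "\<And>n. residue x n = f n mod 2 ^ n"
proof
  fix n
  have "\<forall>n. f (Suc n) mod 2 ^ Suc n mod 2 ^ n = f n mod 2 ^ n"
    using assms by (simp only: mod_mod_power2_Suc mod_eq_dvd_iff simp_thms)
  then show "residue (Abs_two_adic (\<lambda>n. f n mod 2 ^ n)) n = f n mod 2 ^ n"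
    by (subst Abs_two_adic_inverse) auto
qed

lemma cong_pow2_of_residue: "cong_pow2 n x (of_int (residue x n))"
  by (simp add: cong_pow2_iff_residue residue_of_int)

lemma two_adic_eqI_cong: "(\<And>n. cong_pow2 n x y) \<Longrightarrow> x = y"
  by (rule two_adic_eqI) (simp add: cong_pow2_iff_residue)

text \<open>The cancellation takes place among integers, on the representative of \<open>x\<close>
  at level n + m, which is then reduced to level m.\<close>

lemma two_power_dvd_cancel:
  fixes x :: two_adic
  assumes "2 ^ (n + m) dvd 2 ^ n * x"
  shows "2 ^ m dvd x"
proof -
  have "residue (of_int (2 ^ n) * x) (n + m) = 0"
    using assms by (simp add: two_power_dvd_iff_residue)
  then have "2 ^ (n + m) dvd 2 ^ n * residue x (n + m)"
    by (simp add: times_two_adic.rep_eq residue_of_int mod_simps mod_0_imp_dvd del: of_int_power)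
  then have "2 ^ m dvd residue x (n + m)" by (simp add: power_add)
  then have "residue x m = 0" using residue_mod[of m "n + m" x] by simp
  then show ?thesis by (simp add: two_power_dvd_iff_residue)
qed

lemma odf_Suc_cong:
  assumes "e \<ge> 2"
  shows "of_nat (odf (Suc e)) - of_nat (odf e) =
    2 ^ Suc e * (of_nat (odf e) * of_int (wq (Suc e)) :: two_adic)"
proof -
  have "int (odf (Suc e)) - int (odf e) = 2 ^ Suc e * (int (odf e) * wq (Suc e))"
    using assms odd_prod_eq[of "Suc e"] by (simp add: odf_Suc algebra_simps)
  then have "of_int (int (odf (Suc e)) - int (odf e)) =
      (of_int (2 ^ Suc e * (int (odf e) * wq (Suc e))) :: two_adic)"
    by (rule arg_cong)
  then show ?thesis by simp
qed

text \<open>All terms after \<open>odf e\<close> agree with it modulo 2^(e+1). The glued element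
  \<open>x\<close> inherits this, hence is the limit of the sequence, and uniqueness of limits
  identifies it with \<open>z_const\<close>.\<close>

lemma z_const_cong:
  assumes "e \<ge> 2"
  shows "2 ^ Suc e dvd z_const - of_nat (odf e)"
proof -
  have dvd_two_adic: "2 ^ Suc e dvd (of_nat (odf (Suc e)) - of_nat (odf e) :: two_adic)"
    if "e \<ge> 2" for e
    using odf_Suc_cong[OF that] by simp
  \<comment> \<open>The shift by 2 puts the index in the range of \<open>odd_prod_eq\<close>; the
    difference carries 2^(n+3), whence the factor 8.\<close>
  have step: "2 ^ n dvd int (odf (Suc n + 2)) - int (odf (n + 2))" for n
  proof -
    have "int (odf (Suc (n + 2))) - int (odf (n + 2)) =
        2 ^ n * (8 * (int (odf (n + 2)) * wq (Suc (n + 2))))"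
      using odd_prod_eq[of "Suc (n + 2)"] by (simp add: odf_Suc algebra_simps)
    then show ?thesis by simp
  qed
  obtain x where x: "\<And>n. residue x n = int (odf (n + 2)) mod 2 ^ n"
    using residue_exists[of "\<lambda>n. int (odf (n + 2))"] step by blast
  have later: "2 ^ Suc e dvd (of_nat (odf (e + k)) - of_nat (odf e) :: two_adic)"
    if "e \<ge> 2" for e k
  proof (induction k)
    case (Suc k)
    have "2 ^ Suc (e + k) dvd (of_nat (odf (Suc (e + k))) - of_nat (odf (e + k)) :: two_adic)"
      using dvd_two_adic[of "e + k"] that by simp
    then have "2 ^ Suc e dvd (of_nat (odf (Suc (e + k))) - of_nat (odf (e + k)) :: two_adic)"
      by (rule power_le_dvd) simp
    from dvd_add[OF this Suc] show ?case by simp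
  qed simp
  have xe: "2 ^ Suc e dvd x - of_nat (odf e)" if "e \<ge> 2" for e
  proof -
    \<comment> \<open>By the shift in its construction, \<open>x\<close> has at level e + 1 the
      residue of \<open>odf (e + 3)\<close>; \<open>later\<close> leads back to
      \<open>odf e\<close>.\<close>
    have "2 ^ Suc e dvd x - of_nat (odf (e + 3))"
      unfolding cong_pow2_def [symmetric] cong_pow2_iff_residue residue_of_nat x
      by (simp add: eval_nat_numeral)
    from dvd_add[OF this later[OF that, of 3]] show ?thesis by simp
  qed
  have "(\<lambda>e. of_nat (od (fact (2 ^ e)))) \<longlonglongrightarrow> x"
    unfolding two_adic_tendsto_iff odf_def [symmetric] eventually_sequentially
  proof (intro allI exI impI)
    fix n k :: nat assume k: "n + 2 \<le> k"
    have "2 ^ n dvd x - of_nat (odf k)"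
      by (rule power_le_dvd[OF xe]) (use k in simp_all)
    then show "cong_pow2 n (of_nat (odf k)) x"
      unfolding cong_pow2_def by (metis dvd_minus_iff minus_diff_eq)
  qed
  then have "z_const = x" unfolding z_const_def by (rule limI)
  then show ?thesis using xe[OF assms] by simp
qed

text \<open>The definite description is resolved by gluing the residues of \<open>wq\<close> for
  existence and comparing residues for uniqueness.\<close>

lemma w_const_cong:
  assumes "e \<ge> 2"
  shows "2 ^ e dvd w_const - of_int (wq (Suc e))"
proof -
  let ?P = "\<lambda>w. \<forall>e\<ge>3. cong_pow2 (e - 1) w (of_int ((int (odd_prod e) - 1) div 2 ^ e))"
  have "2 ^ n dvd wq (Suc n + 3) - wq (n + 3)" for n
    by (rule power_le_dvd[where n = "n + 2"]) (use wq_Suc_cong[of "n + 2"] in \<open>simp_all add: eval_nat_numeral\<close>)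
  then obtain w where w: "\<And>n. residue w n = wq (n + 3) mod 2 ^ n"
    using residue_exists[of "\<lambda>n. wq (n + 3)"] by blast
  have wP: "?P w"
  proof (intro allI impI)
    fix e :: nat assume "3 \<le> e"
    then obtain k where e: "e = Suc k" and k: "k \<ge> 2" by (cases e) auto
    \<comment> \<open>At level k the residue of \<open>w\<close> is that of
      \<open>wq (k + 3)\<close>, two steps beyond the required \<open>wq (k + 1)\<close>.\<close>
    have 1: "2 ^ k dvd wq (Suc (Suc k)) - wq (Suc k)"
      by (rule wq_Suc_cong) (use k in simp)
    have 2: "2 ^ k dvd wq (Suc (Suc (Suc k))) - wq (Suc (Suc k))"
      by (rule power_le_dvd[OF wq_Suc_cong]) (use k in simp_all)
    have "2 ^ k dvd wq (k + 3) - wq (Suc k)"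
      using dvd_add[OF 2 1] by (simp add: eval_nat_numeral)
    then show "cong_pow2 (e - 1) w (of_int ((int (odd_prod e) - 1) div 2 ^ e))"
      unfolding wq_def [symmetric] by (simp add: cong_pow2_iff_residue residue_of_int w e mod_eq_dvd_iff)
  qed
  moreover have "w' = w" if w': "?P w'" for w'
  proof (rule two_adic_eqI)
    fix n
    \<comment> \<open>The defining property fixes the levels e - 1 \<ge> 2; lower levels follow by
      reduction.\<close>
    have "residue w' (n + 2) = residue w (n + 2)"
      using w'[rule_format, of "n + 3"] wP[rule_format, of "n + 3"]
      by (simp add: cong_pow2_iff_residue)
    then show "residue w' n = residue w n"
      using residue_mod[of n "n + 2" w] residue_mod[of n "n + 2" w'] by simp
  qed
  ultimately have "?P w_const" unfolding w_const_def by (rule theI)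
  from this[rule_format, of "Suc e"] assms show ?thesis
    by (simp add: cong_pow2_def wq_def)
qed

section \<open>The difference between stable and unstable bits\<close>

text \<open>A first-order correction raises the agreement of \<open>odf e\<close> with
  \<open>z_const\<close> from e + 1 to 2e + 1 bits.\<close>

lemma z_const_minus_odf:
  assumes "e \<ge> 2"
  shows "2 ^ (2 * e + 1) dvd z_const - of_nat (odf e) + 2 ^ Suc e * (z_const * w_const)"
proof -
  define b where "b e = z_const - of_nat (odf e) + 2 ^ Suc e * (z_const * w_const)" for e
  have step: "2 ^ (2 * e + 1) dvd b e - b (Suc e)" if "e \<ge> 2" for e
  proof -
    \<comment> \<open>The error of a product is split into the errors of its two factors, each
      divisible by 2^e.\<close>
    have "2 ^ e dvd (z_const - of_nat (odf e)) * w_const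
        + of_nat (odf e) * (w_const - of_int (wq (Suc e)))"
      by (rule dvd_add[OF dvd_mult2[OF power_le_dvd[OF z_const_cong[OF that]]]
            dvd_mult[OF w_const_cong[OF that]]]) simp
    also have "(z_const - of_nat (odf e)) * w_const
        + of_nat (odf e) * (w_const - of_int (wq (Suc e))) =
        z_const * w_const - of_nat (odf e) * of_int (wq (Suc e))"
      by (simp add: algebra_simps)
    finally have "2 ^ Suc e * 2 ^ e dvd
        2 ^ Suc e * (z_const * w_const - of_nat (odf e) * of_int (wq (Suc e)))"
      by (rule mult_dvd_mono[OF dvd_refl])
    also have "\<dots> = b (Suc e) - b e"
      using odf_Suc_cong[OF that] by (simp add: b_def algebra_simps)
    finally have "2 ^ (Suc e + e) dvd b (Suc e) - b e"
      by (simp only: power_add)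
    then have "2 ^ (Suc e + e) dvd b e - b (Suc e)"
      by (metis dvd_minus_iff minus_diff_eq)
    then show ?thesis by (simp only: mult_2 add_Suc Suc_eq_plus1 [symmetric])
  qed
  have "2 ^ (2 * e + 1) dvd b e - b (e + k)" for k
  proof (induction k)
    case (Suc k)
    have "2 ^ (2 * e + 1) dvd b (e + k) - b (Suc (e + k))"
      by (rule power_le_dvd[OF step]) (use assms in simp_all)
    from dvd_add[OF Suc this] show ?case by simp
  qed simp
  \<comment> \<open>A finite telescope suffices: at index 2e both parts of \<open>b\<close> are
    already divisible by 2^(2e+1).\<close>
  from this[of e] have "2 ^ (2 * e + 1) dvd b e - b (2 * e)"
    by (simp only: mult_2 [of e, symmetric])
  moreover have "2 ^ (2 * e + 1) dvd b (2 * e)"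
    using z_const_cong[of "2 * e"] assms unfolding b_def
    by (intro dvd_add dvd_mult2 le_imp_power_dvd) simp_all
  ultimately have "2 ^ (2 * e + 1) dvd b e" by (metis dvd_add diff_add_cancel)
  then show ?thesis by (simp add: b_def)
qed

text \<open>Expresses a window of d bits through residues; for m = e + 1 the window sums of
  \<open>z_const\<close> and \<open>odf e\<close> are \<open>stab\<close> and
  \<open>uns\<close>.\<close>

lemma residue_add:
  "residue x (m + d) = residue x m + 2 ^ m * (\<Sum>i<d. of_bool (two_adic_bit x (m + i)) * 2 ^ i)"
  by (induction d) (simp_all add: residue_eq_sum_bits algebra_simps power_add)

lemma stab_minus_uns:
  assumes "e \<ge> 2" "d \<le> e"
  shows "2 ^ d dvd (of_nat (stab (e + 1) d) - of_nat (uns e d) + z_const * w_const :: two_adic)"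
proof -
  let ?N = "e + 1 + d" and ?a = "of_nat (odf e) :: two_adic"
  have low: "residue z_const (e + 1) = residue ?a (e + 1)"
    using z_const_cong[OF assms(1)]
    unfolding cong_pow2_def [symmetric] cong_pow2_iff_residue by simp
  have "residue z_const ?N - residue ?a ?N = 2 ^ Suc e * (int (stab (e + 1) d) - int (uns e d))"
    unfolding residue_add [of _ "e + 1" d] low
    by (simp add: stab_def uns_def two_adic_bit_of_nat odf_def algebra_simps)
  then have "of_int (residue z_const ?N - residue ?a ?N) =
      (of_int (2 ^ Suc e * (int (stab (e + 1) d) - int (uns e d))) :: two_adic)"
    by (rule arg_cong)
  then have eq: "of_int (residue z_const ?N) - of_int (residue ?a ?N) =
      (2 ^ Suc e * (of_nat (stab (e + 1) d) - of_nat (uns e d)) :: two_adic)"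
    by simp
  \<comment> \<open>Both constants are replaced by their residues at level \<open>?N\<close>; d
    \<le> e enters as e + 1 + d \<le> 2e + 1.\<close>
  have "2 ^ ?N dvd (z_const - of_nat (odf e) + 2 ^ Suc e * (z_const * w_const))
      - (z_const - of_int (residue z_const ?N)) + (?a - of_int (residue ?a ?N))"
    by (rule dvd_add[OF dvd_diff[OF power_le_dvd[OF z_const_minus_odf[OF assms(1)]]
          cong_pow2_of_residue[unfolded cong_pow2_def]] cong_pow2_of_residue[unfolded cong_pow2_def]])
      (use assms(2) in simp)
  also have "\<dots> = (of_int (residue z_const ?N) - of_int (residue ?a ?N))
      + 2 ^ Suc e * (z_const * w_const)"
    by simp
  also have "\<dots> = 2 ^ Suc e * (of_nat (stab (e + 1) d) - of_nat (uns e d) + z_const * w_const)"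
    unfolding eq by (simp only: distrib_left)
  finally show ?thesis
    unfolding Suc_eq_plus1 by (rule two_power_dvd_cancel)
qed

lemma uns_stab_difference_minus_zw: "uns_stab_difference (- (z_const * w_const))"
  unfolding uns_stab_difference_def
proof (intro allI impI)
  fix d e :: nat assume "d > 0" "e > d"
  then have "e \<ge> 2" "d \<le> e" by simp_all
  then have "2 ^ d dvd - (of_nat (stab (e + 1) d) - of_nat (uns e d) + z_const * w_const :: two_adic)"
    unfolding dvd_minus_iff by (rule stab_minus_uns)
  also have "- (of_nat (stab (e + 1) d) - of_nat (uns e d) + z_const * w_const) =
      of_nat (uns e d) + - (z_const * w_const) - of_nat (stab (e + 1) d)"
    by simp
  finally show "cong_pow2 d (of_nat (uns e d) + - (z_const * w_const)) (of_nat (stab (e + 1) d))"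
    unfolding cong_pow2_def .
qed

text \<open>Subtracting the two congruences eliminates \<open>uns\<close> and \<open>stab\<close>,
  so K and L agree modulo every power of 2. Taking d = n + 1 keeps d positive at n = 0, and e = n +
  2 exceeds d.\<close>

lemma uns_stab_difference_unique:
  assumes "uns_stab_difference K" "uns_stab_difference L"
  shows "K = L"
proof (rule two_adic_eqI_cong)
  fix n
  have *: "cong_pow2 (Suc n) (of_nat (uns (n + 2) (Suc n)) + M)
      (of_nat (stab (n + 2 + 1) (Suc n)))" if "uns_stab_difference M" for M
    using that[unfolded uns_stab_difference_def, rule_format, of "Suc n" "n + 2"] by simp
  have "2 ^ Suc n dvd K - L"
    using dvd_diff[OF *[OF assms(1), unfolded cong_pow2_def] *[OF assms(2), unfolded cong_pow2_def]]
    by simp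
  then show "cong_pow2 n K L" unfolding cong_pow2_def by (rule power_le_dvd) simp
qed

theorem theorem2p11:
  shows "(\<exists>!K. uns_stab_difference K) \<and>
    (\<forall>K. uns_stab_difference K \<longrightarrow> K = - (z_const * w_const))"
  using uns_stab_difference_minus_zw uns_stab_difference_unique by blast

end
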